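(* Let $\mathbf{A}\in\mathbb{R}^{d\times d}$ be symmetric positive definite, $\mathbf{b}\in\mathbb{R}^d$, $\mu\ge 0$, and $\mathbf{A}_\mu=\mathbf{A}+\mu\mathbf{I}$. Fix any matrix $\mathbf{\Omega}\in\mathbb{R}^{d\times m}$ and let $\mathbf{P}_\mu=(\mathbf{I}+\mathbf{X})^{-1}$ be any (symmetric positive definite) preconditioner with $\operatorname{range}(\mathbf{X})\subseteq\mathcal{K}_{s+1}(\mathbf{A},\mathbf{\Omega})$. Let $\mathrm{bcg}_t^{(1)}(\mu)$ be the first $t$-th block-CG iterate for the augmented starting block $\mathbf{B}=[\mathbf{b}~\mathbf{\Omega}]$, and let $\mathrm{pcg}_{k}(\mu)$ be the $k$-th preconditioned CG iterate corresponding to $\mathbf{P}_\mu$. Then, for any $t\ge s$, $$\|\mathbf{A}_\mu^{-1}\mathbf{b}-\mathrm{bcg}_t^{(1)}(\mu)\|_{\mathbf{A}_\mu}\le\|\mathbf{A}_\mu^{-1}\mathbf{b}-\mathrm{pcg}_{t-s}(\mu)\|_{\mathbf{A}_\mu}.$$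
   Context: For symmetric positive definite $\mathbf{M}$, $\|\mathbf{x}\|_{\mathbf{M}}=\sqrt{\mathbf{x}^{\mathsf T}\mathbf{M}\mathbf{x}}$. For a square matrix $\mathbf{M}$ and a vector $\mathbf{v}$, $\mathcal{K}_t(\mathbf{M},\mathbf{v})=\operatorname{span}\{\mathbf{v},\mathbf{M}\mathbf{v},\dots,\mathbf{M}^{t-1}\mathbf{v}\}$ (with $\mathcal{K}_0=\{0\}$); for a matrix $\mathbf{V}$ with columns $\mathbf{v}^{(1)},\dots,\mathbf{v}^{(k)}$, the block Krylov subspace is $\mathcal{K}_t(\mathbf{M},\mathbf{V})=\mathcal{K}_t(\mathbf{M},\mathbf{v}^{(1)})+\cdots+\mathcal{K}_t(\mathbf{M},\mathbf{v}^{(k)})$. Preconditioned CG: for a symmetric positive definite preconditioner $\mathbf{P}_\mu$, $\mathrm{pcg}_t(\mu)=\operatorname{argmin}\{\|\mathbf{A}_\mu^{-1}\mathbf{b}-\mathbf{x}\|_{\mathbf{A}_\mu}:\mathbf{x}\in\mathcal{K}_t(\mathbf{P}_\mu^{-1}\mathbf{A}_\mu,\mathbf{P}_\mu^{-1}\mathbf{b})\}$. Block-CG: for $\mathbf{B}$ with columns $\mathbf{b}^{(1)},\mathbf{b}^{(2)},\dots$, $\mathrm{bcg}_t^{(i)}(\mu)=\operatorname{argmin}\{\|\mathbf{A}_\mu^{-1}\mathbf{b}^{(i)}-\mathbf{x}\|_{\mathbf{A}_\mu}:\mathbf{x}\in\mathcal{K}_t(\mathbf{A}_\mu,\mathbf{B})\}$.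 Here $s,t$ are nonnegative integers. *)

theory Defs
  imports "HOL-Analysis.Analysis"
begin

definition spd :: "real^'n^'n \<Rightarrow> bool" where
  "spd M \<longleftrightarrow> transpose M = M \<and> (\<forall>x. x \<noteq> 0 \<longrightarrow> 0 < x \<bullet> (M *v x))"

definition mnorm :: "real^'n^'n \<Rightarrow> real^'n \<Rightarrow> real" where
  "mnorm M x = sqrt (x \<bullet> (M *v x))"

definition shift :: "real^'n^'n \<Rightarrow> real \<Rightarrow> real^'n^'n" where
  "shift A \<mu> = A + \<mu> *\<^sub>R mat 1"

definition krylov :: "nat \<Rightarrow> real^'n^'n \<Rightarrow> real^'n \<Rightarrow> (real^'n) set" where
  "krylov t M v = span ((\<lambda>i. (((*v) M) ^^ i) v) ` {..<t})"

text \<open>The sum below is the elementwise (Minkowski) sum of sets.\<close>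

definition block_krylov :: "nat \<Rightarrow> real^'n^'n \<Rightarrow> real^'k^'n \<Rightarrow> (real^'n) set" where
  "block_krylov t M V = (\<Sum>j\<in>UNIV. krylov t M (column j V))"

text \<open>The block matrix with \<open>b\<close> as its first column, followed by the columns of \<open>\<Omega>\<close>:
  its columns are indexed by \<^typ>\<open>'m option\<close>, where \<^const>\<open>None\<close> is the first column.\<close>

definition augment :: "real^'n \<Rightarrow> real^'m^'n \<Rightarrow> real^('m option)^'n" where
  "augment b \<Omega> = (\<chi> i j. case j of None \<Rightarrow> b $ i | Some k \<Rightarrow> \<Omega> $ i $ k)"

text \<open>In both iterates the minimizer exists and is unique when \<open>shift A \<mu>\<close> is positive definite,
  so the choice made by \<^const>\<open>arg_min_on\<close> is irrelevant.\<close>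

definition pcg :: "real^'n^'n \<Rightarrow> real^'n \<Rightarrow> real^'n^'n \<Rightarrow> real \<Rightarrow> nat \<Rightarrow> real^'n" where
  "pcg A b P \<mu> t =
     arg_min_on (\<lambda>x. mnorm (shift A \<mu>) (matrix_inv (shift A \<mu>) *v b - x))
       (krylov t (matrix_inv P ** shift A \<mu>) (matrix_inv P *v b))"

definition bcg :: "real^'n^'n \<Rightarrow> real^'k^'n \<Rightarrow> 'k \<Rightarrow> real \<Rightarrow> nat \<Rightarrow> real^'n" where
  "bcg A B i \<mu> t =
     arg_min_on (\<lambda>x. mnorm (shift A \<mu>) (matrix_inv (shift A \<mu>) *v column i B - x))
       (block_krylov t (shift A \<mu>) B)"

end

theory Submission
  imports Defs
begin

text \<open>
  Block-CG minimizes the same error functional as preconditioned CG, so it is enough that its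
  search space contains that of preconditioned CG. Write \<open>M = A + \<mu>I\<close>; since \<open>P\<inverse> = I + X\<close>, the
  search space of preconditioned CG is spanned by the vectors \<open>v\<^sub>i = ((I + X) M)\<^sup>i (I + X) b\<close>
  with \<open>i < t - s\<close>. The subspaces \<open>K\<^sub>k = \<K>\<^sub>k(M, [b \<Omega>])\<close> increase with \<open>k\<close>, and \<open>M\<close> maps \<open>K\<^sub>k\<close>
  into \<open>K\<^sub>k\<^sub>+\<^sub>1\<close>. The range of \<open>X\<close> lies in \<open>\<K>\<^sub>s\<^sub>+\<^sub>1(A, \<Omega>)\<close>, which is contained in \<open>K\<^sub>s\<^sub>+\<^sub>1\<close>
  because Krylov subspaces do not change under a shift of the matrix by a multiple of the identity
  (lemma \<open>block_krylov_subset_shift\<close>). Hence an application of \<open>I + X\<close> never leaves a \<open>K\<^sub>k\<close>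
  with \<open>k > s\<close>: the preconditioner costs \<open>s\<close> extra iterations in total, not \<open>s\<close> per step. By
  induction \<open>v\<^sub>i \<in> K\<^sub>s\<^sub>+\<^sub>1\<^sub>+\<^sub>i\<close> (lemma \<open>krylov_preconditioned_subset\<close>), which lies in \<open>K\<^sub>t\<close> for
  all \<open>i < t - s\<close>.

  The iterates are given by a choice operator, so one also needs that the minima are attained. This
  is the existence of the \<open>M\<close>-orthogonal projection onto a subspace.
\<close>

section \<open>Best approximation in the energy norm\<close>

text \<open>If \<open>W\<close> is the \<open>M\<close>-orthogonal complement of \<open>S\<close>, a vector orthogonal to \<open>S + W\<close> is of the form
  \<open>M y\<close> with \<open>y \<in> S\<close>, because it is orthogonal to \<open>W = (M S)\<^sup>\<bottom>\<close>; being orthogonal to \<open>y\<close> as well, it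
  vanishes. So \<open>S + W\<close> is the whole space, and the \<open>S\<close>-component of \<open>c\<close> is the projection.\<close>

lemma spd_projection_exists:
  fixes M :: "real^'n^'n"
  assumes M: "spd M" and S: "subspace S"
  shows "\<exists>x\<in>S. \<forall>y\<in>S. (M *v y) \<bullet> (c - x) = 0"
proof -
  define W where "W = ((*v) M ` S)\<^sup>\<bottom>"
  define T where "T = {x + w |x w. x \<in> S \<and> w \<in> W}"
  have MS: "subspace ((*v) M ` S)"
    using S by (intro linear_subspace_image) auto
  have W: "subspace W"
    unfolding W_def by (rule subspace_orthogonal_comp)
  have T: "subspace T"
    unfolding T_def using S W by (rule subspace_sums)
  obtain u z where u: "u \<in> span T" and z: "\<And>w. w \<in> span T \<Longrightarrow> orthogonal z w" and c: "c = u + z"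
    using orthogonal_subspace_decomp_exists by blast
  have zT: "orthogonal z w" if "w \<in> T" for w
    using z that by (simp add: span_base)
  have "S \<subseteq> T" "W \<subseteq> T"
    unfolding T_def using subspace_0[OF S] subspace_0[OF W] by force+
  then have "z \<in> W\<^sup>\<bottom>"
    using zT by (auto simp: orthogonal_comp_def orthogonal_commute)
  then have "z \<in> (*v) M ` S"
    unfolding W_def using orthogonal_comp_self[OF MS] by simp
  then obtain y where y: "y \<in> S" "z = M *v y"
    by auto
  have "y \<bullet> (M *v y) = 0"
    using zT[of y] y \<open>S \<subseteq> T\<close> by (auto simp: orthogonal_def inner_commute)
  then have "y = 0"
    using M unfolding spd_def by force
  then have "c \<in> T"
    using c y u T by (simp add: span_eq_iff[THEN iffD2])
  then obtain x w where x: "x \<in> S" and w: "w \<in> W" and "c = x + w"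
    unfolding T_def by blast
  then have "\<forall>y\<in>S. (M *v y) \<bullet> (c - x) = 0"
    by (auto simp: W_def orthogonal_comp_def orthogonal_def)
  with x show ?thesis
    by blast
qed

lemma mnorm_minimizer_exists:
  fixes M :: "real^'n^'n"
  assumes M: "spd M" and S: "subspace S"
  shows "\<exists>x\<in>S. \<forall>y\<in>S. mnorm M (c - x) \<le> mnorm M (c - y)"
proof -
  obtain x where x: "x \<in> S" and orth: "\<And>y. y \<in> S \<Longrightarrow> (M *v y) \<bullet> (c - x) = 0"
    using spd_projection_exists[OF M S] by blast
  have sym: "p \<bullet> (M *v q) = (M *v p) \<bullet> q" for p q
    using M by (metis dot_lmul_matrix spd_def transpose_matrix_vector)
  have "mnorm M (c - x) \<le> mnorm M (c - y)" if "y \<in> S" for y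
  proof -
    define e d where "e = c - x" and "d = x - y"
    have "d \<in> S"
      unfolding d_def using x that S by (rule subspace_diff[rotated 1])
    then have de: "(M *v d) \<bullet> e = 0"
      using orth by (simp add: e_def)
    have "0 \<le> d \<bullet> (M *v d)"
      using M unfolding spd_def by (cases "d = 0") (auto intro: less_imp_le)
    moreover have "(e + d) \<bullet> (M *v (e + d)) = e \<bullet> (M *v e) + d \<bullet> (M *v d)"
      using de sym[of d e]
      by (simp add: matrix_vector_right_distrib inner_add_left inner_add_right inner_commute)
    moreover have "c - y = e + d"
      by (simp add: e_def d_def)
    ultimately show ?thesis
      by (simp add: mnorm_def flip: e_def)
  qed
  with x show ?thesis
    by blast
qed

lemma arg_min_on_mnorm:
  fixes M :: "real^'n^'n" and c :: "real^'n"
  assumes "spd M" "subspace S"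
  defines "z \<equiv> arg_min_on (\<lambda>x. mnorm M (c - x)) S"
  shows "z \<in> S" and "\<And>y. y \<in> S \<Longrightarrow> mnorm M (c - z) \<le> mnorm M (c - y)"
proof -
  have "\<exists>x. is_arg_min (\<lambda>x. mnorm M (c - x)) (\<lambda>x. x \<in> S) x"
    using mnorm_minimizer_exists[OF assms(1,2), of c] unfolding is_arg_min_linorder by blast
  then have "is_arg_min (\<lambda>x. mnorm M (c - x)) (\<lambda>x. x \<in> S) z"
    unfolding z_def arg_min_on_def arg_min_def by (rule someI_ex)
  then show "z \<in> S" and "\<And>y. y \<in> S \<Longrightarrow> mnorm M (c - z) \<le> mnorm M (c - y)"
    by (auto simp: is_arg_min_linorder)
qed

section \<open>Block Krylov subspaces\<close>

lemma sum_span_eq_span_UN: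
  fixes G :: "'i \<Rightarrow> 'a::real_vector set"
  assumes "finite J"
  shows "(\<Sum>j\<in>J. span (G j)) = span (\<Union>j\<in>J. G j)"
  using assms
  by (induction J rule: finite_induct) (auto simp: span_Un set_plus_def)

lemma block_krylov_eq_span:
  "block_krylov t M V = span {(((*v) M) ^^ i) (column j V) |i j. i < t}"
  unfolding block_krylov_def krylov_def
  by (subst sum_span_eq_span_UN) (auto intro!: arg_cong[where f = span])

lemma subspace_block_krylov: "subspace (block_krylov t M V)"
  by (simp add: block_krylov_eq_span)

lemma block_krylov_mono: "k \<le> l \<Longrightarrow> block_krylov k M V \<subseteq> block_krylov l M V"
  unfolding block_krylov_eq_span by (rule span_mono) fastforce

lemma block_krylov_mono_columns:
  assumes "range (\<lambda>j. column j V) \<subseteq> range (\<lambda>j. column j W)"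
  shows "block_krylov k M V \<subseteq> block_krylov k M W"
  unfolding block_krylov_eq_span
proof (rule span_mono, clarify)
  fix i j
  assume "i < k"
  moreover obtain j' where "column j V = column j' W"
    using assms by blast
  ultimately show "\<exists>i' j'. (((*v) M) ^^ i) (column j V) = (((*v) M) ^^ i') (column j' W) \<and> i' < k"
    by metis
qed

lemma column_in_block_krylov: "column j V \<in> block_krylov (Suc k) M V"
  unfolding block_krylov_eq_span by (rule span_base) (auto intro!: exI[of _ 0])

lemma matrix_vector_mult_block_krylov:
  assumes "x \<in> block_krylov k M V"
  shows "M *v x \<in> block_krylov (Suc k) M V"
proof -
  let ?G = "\<lambda>k. {(((*v) M) ^^ i) (column j V) |i j. i < k}"
  have "(*v) M ` ?G k \<subseteq> ?G (Suc k)"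
  proof clarify
    fix i j
    assume "i < k"
    then show "\<exists>i' j'. M *v (((*v) M) ^^ i) (column j V) = (((*v) M) ^^ i') (column j' V) \<and> i' < Suc k"
      by (intro exI[of _ "Suc i"] exI[of _ j]) simp
  qed
  then have "span ((*v) M ` ?G k) \<subseteq> span (?G (Suc k))"
    by (rule span_mono)
  moreover have "span ((*v) M ` ?G k) = (*v) M ` span (?G k)"
    by (rule linear_span_image) simp
  ultimately show ?thesis
    using assms unfolding block_krylov_eq_span by blast
qed

lemma shift_mult_vec: "shift A \<mu> *v x = A *v x + \<mu> *\<^sub>R x"
  by (simp add: shift_def matrix_vector_mult_add_rdistrib flip: scaleR_matrix_vector_assoc)

text \<open>\<open>A x = (A + \<mu>I) x - \<mu> x\<close>, so multiplication by \<open>A\<close> raises the index of a Krylov subspace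
  of the shifted matrix by at most one.\<close>

lemma block_krylov_subset_shift:
  "block_krylov k A V \<subseteq> block_krylov k (shift A \<mu>) V"
proof -
  let ?K = "\<lambda>k. block_krylov k (shift A \<mu>) V"
  have step: "A *v x \<in> ?K (Suc k)" if "x \<in> ?K k" for k x
  proof -
    have "shift A \<mu> *v x \<in> ?K (Suc k)"
      using that by (rule matrix_vector_mult_block_krylov)
    moreover have "x \<in> ?K (Suc k)"
      using that block_krylov_mono[of k "Suc k"] by auto
    ultimately have "shift A \<mu> *v x - \<mu> *\<^sub>R x \<in> ?K (Suc k)"
      by (intro subspace_diff subspace_scale subspace_block_krylov)
    then show ?thesis
      by (simp add: shift_mult_vec)
  qed
  have pow: "(((*v) A) ^^ i) (column j V) \<in> ?K (Suc i)" for i j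
    by (induction i) (auto intro: column_in_block_krylov step)
  have "{(((*v) A) ^^ i) (column j V) |i j. i < k} \<subseteq> ?K k"
  proof clarify
    fix i j
    assume "i < k"
    then show "(((*v) A) ^^ i) (column j V) \<in> ?K k"
      by (intro subsetD[OF block_krylov_mono pow]) simp
  qed
  then show ?thesis
    unfolding block_krylov_eq_span[of k A] by (rule span_minimal) (rule subspace_block_krylov)
qed

section \<open>Comparison of the two methods\<close>

text \<open>The index rises only in the multiplications by \<open>M\<close>: the term contributed by \<open>X\<close> is back in
  \<open>\<K>\<^sub>s\<^sub>+\<^sub>1\<close> whatever it is applied to.\<close>

lemma krylov_preconditioned_subset:
  fixes M X :: "real^'n^'n" and V :: "real^'k^'n"
  assumes X: "\<And>x. X *v x \<in> block_krylov (Suc s) M V" and "s \<le> t"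
  shows "krylov (t - s) ((mat 1 + X) ** M) ((mat 1 + X) *v column j V) \<subseteq> block_krylov t M V"
proof -
  let ?K = "\<lambda>k. block_krylov k M V"
  have precond: "(mat 1 + X) *v x \<in> ?K k" if "x \<in> ?K k" "s < k" for x k
  proof -
    have "X *v x \<in> ?K k"
      using X block_krylov_mono[of "Suc s" k] that by auto
    with that show ?thesis
      by (simp add: matrix_vector_mult_add_rdistrib subspace_add subspace_block_krylov)
  qed
  have pow: "(((*v) ((mat 1 + X) ** M)) ^^ i) ((mat 1 + X) *v column j V) \<in> ?K (Suc (s + i))" for i
  proof (induction i)
    case 0
    show ?case
      by (simp add: precond column_in_block_krylov)
  next
    case (Suc i)
    then show ?case
      by (auto simp: precond matrix_vector_mult_block_krylov simp flip: matrix_vector_mul_assoc)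
  qed
  have "(((*v) ((mat 1 + X) ** M)) ^^ i) ((mat 1 + X) *v column j V) \<in> ?K t" if "i < t - s" for i
    using that by (intro subsetD[OF block_krylov_mono pow]) simp
  then show ?thesis
    unfolding krylov_def by (intro span_minimal subspace_block_krylov) auto
qed

lemma spd_shift:
  assumes "spd A" "\<mu> \<ge> 0"
  shows "spd (shift A \<mu>)"
proof -
  have "transpose (shift A \<mu>) = shift A \<mu>"
    using assms(1) by (simp add: spd_def shift_def transpose_def vec_eq_iff mat_def)
  moreover have "0 < x \<bullet> (shift A \<mu> *v x)" if "x \<noteq> 0" for x
    using assms that by (simp add: spd_def shift_mult_vec inner_add_right add_pos_nonneg)
  ultimately show ?thesis
    by (simp add: spd_def)
qed

lemma matrix_inv_matrix_inv:
  fixes M :: "real^'n^'n"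
  assumes "invertible M"
  shows "matrix_inv (matrix_inv M) = M"
proof -
  have inv: "N ** matrix_inv N = mat 1 \<and> matrix_inv N ** N = mat 1"
    if "invertible N" for N :: "real^'n^'n"
    using that unfolding invertible_def matrix_inv_def by (rule someI_ex)
  have "invertible (matrix_inv M)"
    using inv[OF assms] unfolding invertible_def by blast
  then show ?thesis
    using inv[OF assms] inv by (metis matrix_mul_assoc matrix_mul_lid matrix_mul_rid)
qed

lemma column_augment:
  "column None (augment b \<Omega>) = b"
  "column (Some k) (augment b \<Omega>) = column k \<Omega>"
  by (simp_all add: column_def augment_def vec_eq_iff)

theorem theorem3p3:
  fixes A P X :: "real^'n^'n"
    and b :: "real^'n"
    and \<Omega> :: "real^'m^'n"
    and \<mu> :: real
    and s t :: nat
  assumes "spd A"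
    and "\<mu> \<ge> 0"
    and "invertible (mat 1 + X)"
    and "P = matrix_inv (mat 1 + X)"
    and "spd P"
    and "range (\<lambda>x. X *v x) \<subseteq> block_krylov (s + 1) A \<Omega>"
    and "t \<ge> s"
  shows "mnorm (shift A \<mu>) (matrix_inv (shift A \<mu>) *v b - bcg A (augment b \<Omega>) None \<mu> t)
       \<le> mnorm (shift A \<mu>) (matrix_inv (shift A \<mu>) *v b - pcg A b P \<mu> (t - s))"
proof -
  let ?M = "shift A \<mu>" and ?B = "augment b \<Omega>"
  have M: "spd ?M"
    using assms(1,2) by (rule spd_shift)
  have P: "matrix_inv P = mat 1 + X"
    using assms(3,4) by (simp add: matrix_inv_matrix_inv)
  have "block_krylov (Suc s) A \<Omega> \<subseteq> block_krylov (Suc s) ?M \<Omega>"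
    by (rule block_krylov_subset_shift)
  also have "\<dots> \<subseteq> block_krylov (Suc s) ?M ?B"
    by (rule block_krylov_mono_columns) (metis column_augment(2) image_subsetI rangeI)
  finally have "X *v x \<in> block_krylov (Suc s) ?M ?B" for x
    using assms(6) by auto
  then have "krylov (t - s) (matrix_inv P ** ?M) (matrix_inv P *v b) \<subseteq> block_krylov t ?M ?B"
    using krylov_preconditioned_subset[of X s ?M ?B t None] assms(7) by (simp add: P column_augment)
  moreover have "pcg A b P \<mu> (t - s) \<in> krylov (t - s) (matrix_inv P ** ?M) (matrix_inv P *v b)"
    unfolding pcg_def by (rule arg_min_on_mnorm(1)[OF M]) (simp add: krylov_def)
  ultimately have "pcg A b P \<mu> (t - s) \<in> block_krylov t ?M ?B"
    by blast
  then show ?thesis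
    unfolding bcg_def column_augment
    by (rule arg_min_on_mnorm(2)[OF M subspace_block_krylov])
qed

end
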